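(* Let $n \geq 1$ be a natural number and let $K$ be a field in which every polynomial of degree $n$ (with coefficients in $K$) has a root. Let $T\colon M_n(K) \to M_n(K)$ be a linear map. Then $T$ preserves $\mathcal{H}$ if and only if one of the following holds: - $T = 0$; - there exist $P, Q \in GL_n(K)$ such that $T(A) = PAQ$ for all $A \in M_n(K)$; - there exist $P, Q \in GL_n(K)$ such that $T(A) = PA^TQ$ for all $A \in M_n(K)$.
   Context: $M_n(K)$ is the set of $n \times n$ matrices over $K$, viewed as a $K$-vector space and as a monoid under multiplication; $GL_n(K)$ is its group of invertible matrices; $A^T$ is the transpose of $A$. Green's relations on $M_n(K)$: $A\,\mathcal{L}\,B$ if there exist $X, Y \in M_n(K)$ with $A = XB$ and $B = YA$; $A\,\mathcal{R}\,B$ if there exist $X, Y \in M_n(K)$ with $A = BX$ and $B = AY$; $A\,\mathcal{H}\,B$ if $A\,\mathcal{L}\,B$ and $A\,\mathcal{R}\,B$. $T$ preserves $\mathcal{H}$ if $A\,\mathcal{H}\,B$ implies $T(A)\,\mathcal{H}\,T(B)$ for all $A,B \in M_n(K)$. *)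

theory Defs
  imports "HOL-Analysis.Analysis" "HOL-Computational_Algebra.Polynomial"
begin

(* The space of n x n matrices over the field K is 'a^'n^'n, with 'a for K and n = CARD('n).
   The matrix product is "**"; "*" on this type is the entrywise product and is not used. *)

definition matrix_scale :: "'a::times \<Rightarrow> 'a^'n^'m \<Rightarrow> 'a^'n^'m"
  where "matrix_scale c A = map_matrix ((*) c) A"

lemma vector_space_matrix_scale:
  "vector_space (matrix_scale :: 'a::field \<Rightarrow> 'a^'n^'m \<Rightarrow> 'a^'n^'m)"
  by unfold_locales (simp_all add: matrix_scale_def vec_eq_iff algebra_simps)

definition green_L :: "'a::semiring_1^'n^'n \<Rightarrow> 'a^'n^'n \<Rightarrow> bool"
  where "green_L A B \<longleftrightarrow> (\<exists>X Y. A = X ** B \<and> B = Y ** A)"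

definition green_R :: "'a::semiring_1^'n^'n \<Rightarrow> 'a^'n^'n \<Rightarrow> bool"
  where "green_R A B \<longleftrightarrow> (\<exists>X Y. A = B ** X \<and> B = A ** Y)"

definition green_H :: "'a::semiring_1^'n^'n \<Rightarrow> 'a^'n^'n \<Rightarrow> bool"
  where "green_H A B \<longleftrightarrow> green_L A B \<and> green_R A B"

definition preserves_H :: "('a::semiring_1^'n^'n \<Rightarrow> 'a^'n^'n) \<Rightarrow> bool"
  where "preserves_H T \<longleftrightarrow> (\<forall>A B. green_H A B \<longrightarrow> green_H (T A) (T B))"

end

(* Proof idea.  All invertible matrices form one H-class, so T maps them into the H-class of T(1).
   If T(1) had a proper nonzero range, A |-> T(A) v would map the invertible matrices into the nonzero
   vectors of a proper subspace, contradicting Dieudonne's bound.  So T vanishes on the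
   invertible matrices, which span, or it maps them to invertible matrices.

   In the second case T(A) is singular for singular A: some pencil Y + tA is invertible for every t,
   whereas det(T(Y) + t T(A)) would have degree n in t and thus a root if T(A) were invertible.
   Hence T is bijective and preserves invertibility in both directions.  A has rank at most 1
   iff every pencil X - tA with X invertible has at most one singular member, so T preserves this
   too.  Spaces of matrices of rank at most 1 share a column or a row, so T maps each
   e_i \<otimes> K^n to some u_i \<otimes> K^n or K^n \<otimes> u_i; the same alternative holds for all i, and up to a
   transposition T(A) = P A Q. *)
theory Submission
  imports Defs
begin

section \<open>Normal form and diagonal pencils\<close>

lemma invertible_iff_ker: "invertible A \<longleftrightarrow> (\<forall>x. A *v x = 0 \<longrightarrow> x = 0)" for A :: "'a::field^'n^'n"
  by (simp add: invertible_left_inverse matrix_left_invertible_ker)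

lemma matrix_scale_nth [simp]: "matrix_scale c A $ i $ j = c * A $ i $ j"
  by (simp add: matrix_scale_def)

lemma matrix_scale_mult_left: "matrix_scale c A ** B = matrix_scale c (A ** B)"
  for A :: "'a::comm_semiring_1^'n^'m"
  by (simp add: matrix_scale_def matrix_matrix_mult_def vec_eq_iff sum_distrib_left ac_simps)

lemma matrix_scale_mult_right: "A ** matrix_scale c B = matrix_scale c (A ** B)"
  for A :: "'a::comm_semiring_1^'n^'m"
  by (simp add: matrix_scale_def matrix_matrix_mult_def vec_eq_iff sum_distrib_left ac_simps)

lemma matrix_mult_add_right_distrib: "(A + B) ** C = A ** C + B ** C"
  for A :: "'a::semiring_1^'n^'m"
  by (simp add: matrix_matrix_mult_def vec_eq_iff sum.distrib distrib_right)

lemma matrix_scale_vector: "matrix_scale c A *v x = c *s (A *v x)"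
  for A :: "'a::comm_semiring_1^'n^'m"
  by (simp add: matrix_scale_def matrix_vector_mult_def vec_eq_iff sum_distrib_left ac_simps)

definition diag_matrix :: "('n \<Rightarrow> 'a::zero) \<Rightarrow> 'a^'n^'n"
  where "diag_matrix d = (\<chi> i j. if i = j then d i else 0)"

lemma diag_matrix_add: "diag_matrix d + diag_matrix e = diag_matrix (\<lambda>i. d i + e i)"
  for d :: "'n::finite \<Rightarrow> 'a::monoid_add"
  by (simp add: diag_matrix_def vec_eq_iff)

lemma diag_matrix_scale: "matrix_scale c (diag_matrix d) = diag_matrix (\<lambda>i. c * d i)"
  for d :: "'n::finite \<Rightarrow> 'a::mult_zero"
  by (simp add: diag_matrix_def matrix_scale_def vec_eq_iff)

text \<open>Lets pencils be built from a normal form: all members share \<open>C\<close> and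
  \<open>B\<close>, so \<open>invertible_diag_equiv\<close> decides each of them by its diagonal
  entries.\<close>

lemma equivalence_diag_pencil:
  fixes d e :: "'n::finite \<Rightarrow> 'a::comm_semiring_1" and B C :: "'a^'n^'n"
  shows "C ** diag_matrix d ** B + matrix_scale t (C ** diag_matrix e ** B) = C ** diag_matrix (\<lambda>i. d i + t * e i) ** B"
  by (simp add: matrix_add_ldistrib matrix_mult_add_right_distrib matrix_scale_mult_left matrix_scale_mult_right
      flip: diag_matrix_add diag_matrix_scale)

lemma diag_matrix_vector: "(diag_matrix d *v x) $ i = d i * x $ i"
  for d :: "'n::finite \<Rightarrow> 'a::semiring_1"
  by (simp add: diag_matrix_def matrix_vector_mult_def if_distrib[of "\<lambda>z. z * _"] cong: if_cong)

lemma invertible_diag_equiv: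
  fixes d :: "'n::finite \<Rightarrow> 'a::field" and B C :: "'a^'n^'n"
  assumes "invertible C" "invertible B"
  shows "invertible (C ** diag_matrix d ** B) \<longleftrightarrow> (\<forall>i. d i \<noteq> 0)"
proof -
  have "det (diag_matrix d) = prod d UNIV"
    by (subst det_diagonal) (auto simp: diag_matrix_def)
  then show ?thesis using assms by (simp add: invertible_det_nz det_mul)
qed

lemma invertible_if_independent_rows:
  fixes a :: "'n \<Rightarrow> 'a::field^'n"
  assumes "inj a" "vec.independent (range a)"
  shows "invertible (\<chi> i. a i)"
proof -
  have "UNIV \<subseteq> vec.span (range a)"
    using assms by (intro vec.card_ge_dim_independent) (auto simp: card_image vec.dim_UNIV vec.dimension_def card_cart_basis)
  moreover have "rows (\<chi> i. a i) = range a" by (auto simp: rows_def row_def vec_lambda_eta)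
  ultimately show ?thesis
    using matrix_left_invertible_span_rows_gen[of "\<chi> i. a i"] by (auto simp: invertible_left_inverse)
qed

lemma invertible_if_independent_columns:
  fixes a :: "'n \<Rightarrow> 'a::field^'n"
  assumes "inj a" "vec.independent (range a)"
  shows "invertible (\<chi> i j. a j $ i)"
proof -
  have "(\<chi> i j. a j $ i) = transpose (\<chi> i. a i)" by (simp add: vec_eq_iff transpose_def)
  then show ?thesis
    using invertible_if_independent_rows[OF assms] by (simp add: invertible_det_nz)
qed

text \<open>Extend a basis of the kernel to the whole space; the added vectors have independent
  images, which extend to a second basis. Relative to these two bases \<open>A\<close> becomes a
  diagonal idempotent. The index type carries no order, so the ones sit on a set \<open>S\<close>
  rather than on an initial segment.\<close>

lemma rank_normal_form:
  fixes A :: "'a::field^'n^'n"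
  obtains C B :: "'a^'n^'n" and S where "invertible C" "invertible B" "A = C ** diag_matrix (indicator S) ** B"
proof -
  define N where "N = {x. A *v x = 0}"
  obtain B0 where B0: "B0 \<subseteq> N" "vec.independent B0" "N \<subseteq> vec.span B0"
    by (rule vec.basis_exists[of N])
  obtain B1 where B1: "B0 \<subseteq> B1" "vec.independent B1" "UNIV \<subseteq> vec.span B1"
    by (rule vec.maximal_independent_subset_extend[OF subset_UNIV B0(2)])
  define D where "D = B1 - B0"
  have finB1: "finite B1" using B1(2) vec.finiteI_independent by blast
  have cB1: "card B1 = CARD('n)"
    using vec.basis_card_eq_dim[OF subset_UNIV B1(3,2)] by (simp add: vec.dim_UNIV vec.dimension_def card_cart_basis)
  have indD: "vec.independent D"
    using vec.independent_mono[OF B1(2), of D] unfolding D_def by auto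
  \<comment> \<open>\<open>D\<close> and \<open>B0\<close> partition the basis \<open>B1\<close>:
    their spans add up to the whole space and their dimensions to \<open>CARD('n)\<close>, so the
    intersection has dimension 0.\<close>
  have DN: "vec.span D \<inter> vec.span B0 \<subseteq> {0}"
  proof -
    have "vec.dim {x + y |x y. x \<in> vec.span D \<and> y \<in> vec.span B0} = CARD('n)"
      unfolding vec.span_Un[symmetric] using B1(1,3)
      by (simp add: D_def Un_absorb1 Un_commute top.extremum_unique vec.dim_UNIV vec.dimension_def card_cart_basis del: vec.dim_span)
    moreover have "vec.dim (vec.span D) + vec.dim (vec.span B0) = CARD('n)"
      using indD B0(2) B1(1) finB1 cB1 unfolding D_def
      by (simp add: vec.dim_eq_card_independent card_Diff_subset finite_subset)
        (metis card_mono le_add_diff_inverse2)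
    ultimately have "vec.dim (vec.span D \<inter> vec.span B0) = 0"
      using vec.dim_sums_Int[OF vec.subspace_span vec.subspace_span, of D B0] by linarith
    then show ?thesis by (simp only: vec.dim_eq_0)
  qed
  have injA: "inj_on ((*v) A) (vec.span D)"
  proof (subst vec.inj_on_iff_eq_0[OF vec.subspace_span], intro ballI impI)
    fix x assume "x \<in> vec.span D" "A *v x = 0"
    then show "x = 0" using DN B0(3) unfolding N_def by blast
  qed
  have indAD: "vec.independent ((*v) A ` D)"
    using vec.independent_injective_image[OF indD injA] .
  obtain C1 where C1: "(*v) A ` D \<subseteq> C1" "vec.independent C1" "UNIV \<subseteq> vec.span C1"
    by (rule vec.maximal_independent_subset_extend[OF subset_UNIV indAD])
  have finC1: "finite C1" using C1(2) vec.finiteI_independent by blast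
  have cC1: "card C1 = CARD('n)"
    using vec.basis_card_eq_dim[OF subset_UNIV C1(3,2)] by (simp add: vec.dim_UNIV vec.dimension_def card_cart_basis)
  have injAD: "inj_on ((*v) A) D" using injA vec.span_superset inj_on_subset by blast
  obtain g where g: "bij_betw g (UNIV :: 'n set) B1"
    using finite_same_card_bij[of "UNIV :: 'n set" B1] finB1 cB1 by auto
  define S where "S = g -` D"
  have gS: "bij_betw g S D"
    using g unfolding S_def D_def bij_betw_def inj_on_def by auto
  have hS: "bij_betw (\<lambda>i. A *v g i) S ((*v) A ` D)"
    using bij_betw_trans[OF gS inj_on_imp_bij_betw[OF injAD]] by (simp add: o_def)
  have "card (- S) = card (C1 - (*v) A ` D)"
    using bij_betw_same_card[OF hS] C1(1) finC1 cC1
    by (simp add: card_Diff_subset finite_subset Compl_eq_Diff_UNIV)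
  then obtain h where h: "bij_betw h (- S) (C1 - (*v) A ` D)"
    using finite_same_card_bij[of "- S" "C1 - (*v) A ` D"] finC1 by auto
  \<comment> \<open>\<open>k\<close> lists \<open>C1\<close> so that on \<open>S\<close> it matches
    the images of the vectors \<open>g i\<close>. Off \<open>S\<close>, where \<open>g i\<close> is
    in the kernel, any remaining basis vector will do, because the zero diagonal entry erases
    it.\<close>
  define k where "k i = (if i \<in> S then A *v g i else h i)" for i
  have "bij_betw k (S \<union> - S) ((*v) A ` D \<union> (C1 - (*v) A ` D))"
    unfolding k_def by (rule bij_betw_disjoint_Un[OF hS h]) auto
  then have k: "bij_betw k UNIV C1" using C1(1) by (simp add: Un_absorb1)
  define G where "G = (\<chi> i j. g j $ i)"
  define C where "C = (\<chi> i j. k j $ i)"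
  have invG: "invertible G"
    unfolding G_def using g B1(2) by (intro invertible_if_independent_columns) (auto simp: bij_betw_def)
  have invC: "invertible C"
    unfolding C_def using k C1(2) by (intro invertible_if_independent_columns) (auto simp: bij_betw_def)
  have "(A ** G) $ r $ j = (C ** diag_matrix (indicator S)) $ r $ j" for r j
  proof -
    have "(A ** G) $ r $ j = (A *v g j) $ r"
      by (simp add: matrix_matrix_mult_def matrix_vector_mult_def G_def)
    moreover have "(C ** diag_matrix (indicator S)) $ r $ j = k j $ r * indicator S j"
      by (simp add: matrix_matrix_mult_def C_def diag_matrix_def if_distrib[of "\<lambda>z. _ * z"] cong: if_cong)
    moreover have "A *v g j = 0" if "j \<notin> S"
      using that g B0(1) unfolding S_def D_def N_def bij_betw_def by auto
    ultimately show ?thesis unfolding k_def by (auto simp: indicator_def)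
  qed
  then have AG: "A ** G = C ** diag_matrix (indicator S)" by (simp add: vec_eq_iff)
  obtain G' where G': "G ** G' = mat 1" "G' ** G = mat 1" using invG unfolding invertible_def by blast
  have "A = C ** diag_matrix (indicator S) ** G'"
    using AG G' by (metis matrix_mul_assoc matrix_mul_rid)
  moreover have "invertible G'" using G' unfolding invertible_def by blast
  ultimately show ?thesis using that invC by blast
qed

section \<open>Singular members of matrix pencils\<close>

text \<open>The determinant of M + t is a polynomial in t of degree exactly n, since only the
  identity permutation collects a factor of degree 1 from every row. The root hypothesis applies to
  it.\<close>

lemma exists_eigenvalue:
  fixes M :: "'a::field^'n^'n"
  assumes root: "\<And>p :: 'a poly. degree p = CARD('n) \<Longrightarrow> \<exists>x. poly p x = 0"
  shows "\<exists>t. \<not> invertible (M + matrix_scale t (mat 1))"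
proof -
  define q where "q i j = [:M $ i $ j, if i = j then 1 else 0:]" for i j
  define P where "P = (\<chi> i j. q i j)"
  define r where "r p = of_int (sign p) * (\<Prod>i\<in>UNIV. q i (p i))" for p
  have poly_det: "poly (det P) t = det (M + matrix_scale t (mat 1))" for t
    by (simp add: det_def P_def q_def poly_sum poly_prod matrix_scale_def mat_def if_distrib[of "\<lambda>p. poly p _"] cong: if_cong)
  have fin: "finite {p. p permutes (UNIV :: 'n set)}" by (simp add: finite_permutations)
  have "det P = (\<Sum>p | p permutes UNIV. r p)"
    by (simp add: det_def P_def r_def)
  also have "\<dots> = r id + (\<Sum>p\<in>{p. p permutes UNIV} - {id}. r p)"
    using fin by (subst sum.remove[of _ id]) (auto simp: permutes_id)
  finally have det: "det P = r id + (\<Sum>p\<in>{p. p permutes UNIV} - {id}. r p)" .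
  have "degree (r id) = (\<Sum>i\<in>UNIV. degree (q i i))"
    unfolding r_def by (simp add: sign_id degree_prod_eq_sum_degree q_def)
  then have deg_id: "degree (r id) = CARD('n)" by (simp add: q_def)
  \<comment> \<open>Such a permutation moves some \<open>i\<close>, and the entry
    \<open>q i (p i)\<close> is then constant, which costs a degree.\<close>
  have "degree (r p) < CARD('n)" if p: "p \<noteq> id" for p
  proof -
    obtain i where "p i \<noteq> i" using p by (metis eq_id_iff)
    have "degree (r p) \<le> degree (\<Prod>i\<in>UNIV. q i (p i))"
      unfolding r_def by (simp add: sign_def)
    also have "\<dots> \<le> (\<Sum>i\<in>UNIV. degree (q i (p i)))"
      using degree_prod_sum_le[of UNIV "\<lambda>i. q i (p i)"] by (simp add: o_def)
    also have "\<dots> < (\<Sum>i\<in>(UNIV :: 'n set). 1)"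
      using \<open>p i \<noteq> i\<close> by (intro sum_strict_mono_ex1) (auto simp: q_def intro!: exI[of _ i])
    finally show ?thesis by simp
  qed
  then have "degree (\<Sum>p\<in>{p. p permutes UNIV} - {id}. r p) < degree (r id)"
    unfolding deg_id using fin by (intro degree_sum_less) auto
  then have "degree (det P) = CARD('n)"
    unfolding det by (simp add: degree_add_eq_left deg_id)
  then show ?thesis using root poly_det by (metis invertible_det_nz)
qed

text \<open>Factoring out \<open>M\<close> leaves a pencil through the identity, to which
  \<open>exists_eigenvalue\<close> applies.\<close>

lemma exists_singular_in_pencil:
  fixes M N :: "'a::field^'n^'n"
  assumes root: "\<And>p :: 'a poly. degree p = CARD('n) \<Longrightarrow> \<exists>x. poly p x = 0"
    and "invertible M"
  shows "\<exists>t. \<not> invertible (N + matrix_scale t M)"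
proof -
  obtain M' where M': "M ** M' = mat 1" using assms(2) unfolding invertible_def by blast
  obtain t where t: "\<not> invertible (M' ** N + matrix_scale t (mat 1))" using exists_eigenvalue[OF root] by blast
  have "N + matrix_scale t M = M ** (M' ** N + matrix_scale t (mat 1))"
    by (simp add: matrix_add_ldistrib matrix_scale_mult_right matrix_mul_assoc M')
  then show ?thesis using t by (metis det_mul invertible_det_nz mult_zero_right)
qed

text \<open>In normal form some diagonal entry i is 0. Adding the permutation matrix of an n-cycle
  gives kernel equations that tie each coordinate to its successor; the one at i makes the successor
  of i vanish whatever t is, and the zero travels round the cycle.\<close>

lemma exists_invertible_pencil:
  fixes A :: "'a::field^'n^'n"
  assumes "\<not> invertible A"
  shows "\<exists>Y. \<forall>t. invertible (Y + matrix_scale t A)"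
proof -
  obtain C B :: "'a^'n^'n" and S where CB: "invertible C" "invertible B" and A: "A = C ** diag_matrix (indicator S) ** B"
    by (rule rank_normal_form[of A])
  then obtain i where i: "i \<notin> S"
    using assms invertible_diag_equiv[OF CB, of "indicator S"] by (auto simp: indicator_def split: if_splits)
  define n where "n = CARD('n)"
  have n: "n > 0" unfolding n_def by simp
  obtain h where h: "bij_betw h {0..<n} (UNIV :: 'n set)"
    using ex_bij_betw_nat_finite[OF finite, of UNIV] unfolding n_def by blast
  have h': "\<exists>l<n. j = h l" for j using h unfolding bij_betw_def by (metis UNIV_I atLeastLessThan_iff imageE)
  \<comment> \<open>\<open>\<sigma>\<close> is the cyclic shift of the indices, carried over from
    \<open>{0..<n}\<close> by the enumeration \<open>h\<close>.\<close>
  obtain \<sigma> where \<sigma>: "\<sigma> (h k) = h (Suc k mod n)" if "k < n" for k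
  proof
    show "(\<lambda>j. h (Suc (inv_into {0..<n} h j) mod n)) (h k) = h (Suc k mod n)" if "k < n" for k
      using that h by (simp add: bij_betw_def inv_into_f_f)
  qed
  define Y where "Y = (\<chi> i j. if j = \<sigma> i then 1 else (0::'a))"
  have Yx: "(Y *v x) $ i = x $ \<sigma> i" for x i
    by (simp add: Y_def matrix_vector_mult_def if_distrib[of "\<lambda>z. z * _"] cong: if_cong)
  obtain m where m: "m < n" "i = h m" using h' by blast
  have inv: "invertible (Y + matrix_scale t (diag_matrix (indicator S)))" for t
    unfolding invertible_iff_ker
  proof (intro allI impI)
    fix x assume "(Y + matrix_scale t (diag_matrix (indicator S))) *v x = 0"
    then have eq: "x $ \<sigma> j + t * (indicator S j * x $ j) = 0" for j
      by (simp add: vec_eq_iff matrix_vector_mult_add_rdistrib Yx diag_matrix_scale diag_matrix_vector mult.assoc)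
    have "x $ h ((m + Suc k) mod n) = 0" for k
    proof (induction k)
      case 0
      show ?case using eq[of i] i \<sigma>[OF m(1)] m by simp
    next
      case (Suc k)
      have "\<sigma> (h ((m + Suc k) mod n)) = h ((m + Suc (Suc k)) mod n)"
        using \<sigma>[of "(m + Suc k) mod n"] n by (simp add: mod_Suc_eq)
      then show ?case using eq[of "h ((m + Suc k) mod n)"] Suc by simp
    qed
    note zero = this
    show "x = 0"
    proof (simp add: vec_eq_iff, intro allI)
      fix j
      obtain l where l: "l < n" "j = h l" using h' by blast
      \<comment> \<open>Every index is reached: \<open>n - 1 - m + l\<close> steps past the
        successor of position \<open>m\<close> end at \<open>n + l\<close>, which is
        \<open>l\<close> modulo \<open>n\<close>.\<close>
      have "m + Suc (n - 1 - m + l) = n + l" using m by simp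
      then have "(m + Suc (n - 1 - m + l)) mod n = l" using l by simp
      then show "x $ j = 0" using zero[of "n - 1 - m + l"] l by metis
    qed
  qed
  have "C ** Y ** B + matrix_scale t A = C ** (Y + matrix_scale t (diag_matrix (indicator S))) ** B" for t
    by (simp add: A matrix_add_ldistrib matrix_mult_add_right_distrib matrix_scale_mult_left matrix_scale_mult_right)
  then show ?thesis using inv CB by (metis invertible_mult)
qed

section \<open>Linear conditions on invertible matrices\<close>

text \<open>
  Dieudonne's bound in terms of rows: with \<open>V\<close> the whole space and \<open>Z = 0\<close> it says that
  fewer than \<open>n\<close> linear equations on \<open>n \<times> n\<close> matrices have an invertible solution. In the induction
  one row \<open>s\<close> is set to \<open>y - c w\<close>, where \<open>L s\<close> maps \<open>y\<close> but not \<open>w\<close> into \<open>Z\<close>; the other rows are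
  found in a hyperplane of \<open>V\<close> containing \<open>w\<close> but not \<open>y\<close>, with \<open>Z\<close> enlarged by \<open>L s w\<close>, and \<open>c\<close>
  then cancels the \<open>L s w\<close> component.
\<close>
lemma exists_independent_family:
  fixes L :: "'i \<Rightarrow> 'a::field^'n^'m" and V :: "('a^'n) set" and Z :: "('a^'m) set"
  assumes "finite S" "vec.subspace V" "vec.subspace Z" "card S \<le> vec.dim V"
    and "CARD('m) < vec.dim Z + card S"
  shows "\<exists>a. inj_on a S \<and> vec.independent (a ` S) \<and> a ` S \<subseteq> V \<and> (\<Sum>s\<in>S. L s *v a s) \<in> Z"
  using assms
proof (induction "card S" arbitrary: S V Z)
  case 0
  then show ?case
    using vec.dim_subset_UNIV[of Z] by (simp add: card_cart_basis vec.dimension_def)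
next
  case (Suc k)
  show ?case
  proof (cases "\<forall>s\<in>S. \<forall>x\<in>V. L s *v x \<in> Z")
    case True
    obtain B where B: "B \<subseteq> V" "vec.independent B" "V \<subseteq> vec.span B" "card B = vec.dim V"
      using vec.basis_exists by blast
    obtain a where a: "inj_on a S" "a ` S \<subseteq> B"
      using card_le_inj[of S B] B Suc.prems vec.finiteI_independent by metis
    show ?thesis
    proof (intro exI[of _ a] conjI)
      show "vec.independent (a ` S)"
        using B a vec.independent_mono by blast
      show "(\<Sum>s\<in>S. L s *v a s) \<in> Z"
        using a B True by (intro vec.subspace_sum[OF Suc.prems(3)]) blast
    qed (use a B in auto)
  next
    case False
    then obtain s w where s: "s \<in> S" and w: "w \<in> V" "L s *v w \<notin> Z" by blast
    \<comment> \<open>Otherwise \<open>L s\<close> is injective on \<open>V\<close> and its image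
      meets \<open>Z\<close> only in 0, so the dimensions of \<open>V\<close> and \<open>Z\<close>
      add up to at most \<open>CARD('m)\<close>, against the two inequalities assumed.\<close>
    have "\<exists>y\<in>V. y \<noteq> 0 \<and> L s *v y \<in> Z"
    proof (rule ccontr)
      assume no: "\<not> ?thesis"
      have spV: "vec.span V = V" by (rule vec.span_eq_iff[THEN iffD2, OF Suc.prems(2)])
      have "inj_on ((*v) (L s)) V"
        using no vec.subspace_0[OF Suc.prems(3)]
        by (subst vec.inj_on_iff_eq_0[OF Suc.prems(2)]) auto
      then have "inj_on ((*v) (L s)) (vec.span V)" unfolding spV .
      then have d: "vec.dim ((*v) (L s) ` V) = vec.dim V"
        by (rule vec.dim_image_eq[OF matrix_vector_mul_linear_gen])
      have "(*v) (L s) ` V \<inter> Z = {0}"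
        using no vec.subspace_0[OF Suc.prems(3)] vec.subspace_0[OF Suc.prems(2)]
        by (auto intro: image_eqI[of _ _ 0])
      then have "vec.dim V + vec.dim Z \<le> CARD('m)"
        using vec.dim_sums_Int[OF vec.subspace_image[OF Suc.prems(2), of "L s"] Suc.prems(3)] d
          vec.dim_subset_UNIV[of "{x + y |x y. x \<in> (*v) (L s) ` V \<and> y \<in> Z}"]
        by (simp add: card_cart_basis vec.dimension_def)
      then show False using Suc.prems by linarith
    qed
    then obtain y where y: "y \<in> V" "y \<noteq> 0" "L s *v y \<in> Z" by blast
    have wy: "w \<notin> vec.span {y}"
      using w y vec.subspace_scale[OF Suc.prems(3), of "L s *v y"]
      by (auto simp: vec.span_singleton vec.scale)
    then have "vec.independent {w, y}" "w \<noteq> y"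
      using y by (auto simp: vec.independent_insert vec.span_base)
    then obtain B where B: "{w, y} \<subseteq> B" "B \<subseteq> V" "vec.independent B" "V \<subseteq> vec.span B"
      using vec.maximal_independent_subset_extend[of "{w,y}" V] w(1) y(1)
      by (metis empty_subsetI insert_subset)
    define V' where "V' = vec.span (B - {y})"
    define Z' where "Z' = vec.span (insert (L s *v w) Z)"
    have finB: "finite B" using B vec.finiteI_independent by blast
    have dV: "vec.dim V = card B"
      using vec.basis_card_eq_dim[OF B(2,4,3)] by simp
    have dV': "vec.dim V' = card B - 1"
      unfolding V'_def vec.dim_span using B(1) finB vec.independent_mono[OF B(3), of "B - {y}"]
      by (subst vec.dim_eq_card_independent) auto
    have V'V: "V' \<subseteq> V"
      unfolding V'_def using B(2) Suc.prems(2) by (intro vec.span_minimal) auto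
    have yV': "y \<notin> V'"
      using B(1,3) unfolding V'_def vec.dependent_def by blast
    have wV': "w \<in> V'"
      unfolding V'_def using B \<open>w \<noteq> y\<close> by (intro vec.span_base) auto
    have dZ': "vec.dim Z' = vec.dim Z + 1"
      unfolding Z'_def vec.dim_span vec.dim_insert using w Suc.prems(3)
      by (simp add: vec.span_eq_iff[THEN iffD2])
    have cS: "card (S - {s}) = k" using Suc s by auto
    have "vec.subspace V'" "vec.subspace Z'" unfolding V'_def Z'_def by simp_all
    \<comment> \<open>\<open>V'\<close> loses one dimension, \<open>Z'\<close> gains one and the
      family loses one vector, so both inequalities survive.\<close>
    moreover have "k = card (S - {s})" "finite (S - {s})" "card (S - {s}) \<le> vec.dim V'"
      "CARD('m) < vec.dim Z' + card (S - {s})"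
      using cS Suc.prems Suc.hyps(2) dV dV' dZ' by auto
    ultimately have "\<exists>a. inj_on a (S - {s}) \<and> vec.independent (a ` (S - {s})) \<and>
      a ` (S - {s}) \<subseteq> V' \<and> (\<Sum>t\<in>S - {s}. L t *v a t) \<in> Z'"
      by (intro Suc.hyps(1))
    then obtain a where a: "inj_on a (S - {s})" "vec.independent (a ` (S - {s}))"
      "a ` (S - {s}) \<subseteq> V'" "(\<Sum>t\<in>S - {s}. L t *v a t) \<in> Z'"
      by (elim exE conjE)
    obtain c where "(\<Sum>t\<in>S - {s}. L t *v a t) - c *s (L s *v w) \<in> vec.span Z"
      using a(4) unfolding Z'_def vec.span_breakdown_eq by metis
    then have c: "(\<Sum>t\<in>S - {s}. L t *v a t) - c *s (L s *v w) \<in> Z"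
      unfolding vec.span_eq_iff[THEN iffD2, OF Suc.prems(3)] .
    define b where "b = a(s := y - c *s w)"
    have img: "b ` S = insert (y - c *s w) (a ` (S - {s}))"
      using s unfolding b_def by (auto simp: image_iff)
    have V'sub: "vec.subspace V'" unfolding V'_def by simp
    have new: "y - c *s w \<notin> V'"
      using yV' vec.subspace_add[OF V'sub _ vec.subspace_scale[OF V'sub wV', of c], of "y - c *s w"] by auto
    show ?thesis
    proof (intro exI[of _ b] conjI)
      show "inj_on b S"
        using a new unfolding b_def inj_on_def by auto
      have "y - c *s w \<notin> vec.span (a ` (S - {s}))"
        using new vec.span_minimal[OF a(3) V'sub] by blast
      then show "vec.independent (b ` S)"
        unfolding img using a(2) by (simp add: vec.independent_insert)
      have "y - c *s w \<in> V"
        by (intro vec.subspace_diff vec.subspace_scale Suc.prems(2) y(1) w(1))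
      then show "b ` S \<subseteq> V"
        unfolding img using a(3) V'V by blast
      have "(\<Sum>t\<in>S. L t *v b t) = L s *v y - c *s (L s *v w) + (\<Sum>t\<in>S - {s}. L t *v a t)"
        unfolding b_def using s Suc.prems(1)
        by (simp add: sum.remove vec.diff vec.scale)
      also have "\<dots> = L s *v y + ((\<Sum>t\<in>S - {s}. L t *v a t) - c *s (L s *v w))" by simp
      also have "\<dots> \<in> Z" using y(3) c by (rule vec.subspace_add[OF Suc.prems(3)])
      finally show "(\<Sum>s\<in>S. L s *v b s) \<in> Z" .
    qed
  qed
qed

text \<open>A matrix is the sum of its rows, each placed in an otherwise zero matrix, and on each
  row position \<open>F\<close> is a linear map of vectors. This is the shape required by
  \<open>exists_independent_family\<close>.\<close>

lemma linear_of_rows: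
  fixes F :: "'a::field^'n^'l \<Rightarrow> 'a^'m"
  assumes "Vector_Spaces.linear matrix_scale (*s) F"
  shows "\<exists>L :: 'l \<Rightarrow> 'a^'n^'m. \<forall>A. F A = (\<Sum>s\<in>UNIV. L s *v row s A)"
proof -
  interpret F: Vector_Spaces.linear matrix_scale "(*s)" F by fact
  define e where "e s x = (\<chi> i. if i = s then x else 0)" for s :: 'l and x :: "'a^'n"
  have "Vector_Spaces.linear (*s) (*s) (\<lambda>x. F (e s x))" for s
  proof (unfold_locales, goal_cases)
    case (1 x y)
    have "e s (x + y) = e s x + e s y" by (simp add: e_def vec_eq_iff)
    then show ?case by (simp add: F.add)
  next
    case (2 c x)
    have "e s (c *s x) = matrix_scale c (e s x)" by (simp add: e_def vec_eq_iff matrix_scale_def)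
    then show ?case by (simp add: F.scale)
  qed
  note L = matrix_works[OF this]
  have "F A = (\<Sum>s\<in>UNIV. matrix (\<lambda>x. F (e s x)) *v row s A)" for A
  proof -
    have "A = (\<Sum>s\<in>UNIV. e s (row s A))"
      by (simp add: vec_eq_iff e_def row_def if_distrib[of "\<lambda>v. v $ _"] cong: if_cong)
    then show ?thesis by (metis (no_types, lifting) L F.sum sum.cong)
  qed
  then have "\<forall>A. F A = (\<Sum>s\<in>UNIV. matrix (\<lambda>x. F (e s x)) *v row s A)" ..
  then show ?thesis by (rule exI[of _ "\<lambda>s. matrix (\<lambda>x. F (e s x))"])
qed

text \<open>Modulo the line of \<open>z\<close> the condition is only n - 1 equations. The line
  serves as \<open>Z\<close> in \<open>exists_independent_family\<close>, and its dimension 1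
  supplies the strict inequality.\<close>

lemma exists_invertible_mapped_into_line:
  fixes F :: "'a::field^'n^'n \<Rightarrow> 'a^'n"
  assumes "Vector_Spaces.linear matrix_scale (*s) F" "z \<noteq> 0"
  shows "\<exists>A c. invertible A \<and> F A = c *s z"
proof -
  obtain L where L: "\<And>A. F A = (\<Sum>s\<in>UNIV. L s *v row s A)"
    using linear_of_rows[OF assms(1)] by blast
  have "vec.dim (vec.span {z}) = 1"
    unfolding vec.dim_span using assms by (simp add: vec.dim_eq_card_independent)
  then obtain a where a: "inj a" "vec.independent (range a)" "(\<Sum>s\<in>UNIV. L s *v a s) \<in> vec.span {z}"
    using exists_independent_family[of "UNIV :: 'n set" UNIV "vec.span {z}" L]
    by (auto simp: vec.dim_UNIV vec.dimension_def card_cart_basis)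
  have "F (\<chi> i. a i) \<in> vec.span {z}"
    using a(3) by (simp add: L row_def vec_lambda_eta)
  then show ?thesis
    using invertible_if_independent_rows[OF a(1,2)] by (auto simp: vec.span_singleton)
qed


section \<open>From Green's relation H to invertible matrices\<close>

lemma preserves_H_linear_cases:
  fixes T :: "'a::field^'n^'n \<Rightarrow> 'a^'n^'n"
  assumes lin: "Vector_Spaces.linear matrix_scale matrix_scale T" and H: "preserves_H T"
  shows "(\<forall>A. invertible A \<longrightarrow> T A = 0) \<or> (\<forall>A. invertible A \<longrightarrow> invertible (T A))"
proof -
  interpret T: Vector_Spaces.linear matrix_scale matrix_scale T by fact
  \<comment> \<open>Invertible \<open>A\<close> is H-related to \<open>mat 1\<close>. The
    factorisations say that \<open>T A\<close> has its range inside that of \<open>T (mat 1)\<close>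
    and has the same kernel.\<close>
  have HT: "\<exists>X Y Z. T A = T (mat 1) ** X \<and> T A = Z ** T (mat 1) \<and> T (mat 1) = Y ** T A" if A: "invertible A" for A
  proof -
    obtain A' where A': "A ** A' = mat 1" "A' ** A = mat 1"
      using A unfolding invertible_def by blast
    have "A = A ** mat 1 \<and> mat 1 = A' ** A" "A = mat 1 ** A \<and> mat 1 = A ** A'"
      using A' by simp_all
    then have "green_H A (mat 1)"
      unfolding green_H_def green_L_def green_R_def by blast
    then have "green_H (T A) (T (mat 1))" using H unfolding preserves_H_def by blast
    then show ?thesis unfolding green_H_def green_L_def green_R_def by blast
  qed
  show ?thesis
  proof (cases "invertible (T (mat 1))")
    case True
    have "invertible (T A)" if "invertible A" for A
      using HT[OF that] True unfolding invertible_iff_ker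
      by (metis matrix_vector_mul_assoc matrix_vector_mult_0_right)
    then show ?thesis by blast
  next
    case False
    have "T (mat 1) = 0"
    proof (rule ccontr)
      assume "T (mat 1) \<noteq> 0"
      \<comment> \<open>\<open>v\<close> is outside the common kernel and \<open>z\<close> outside
        the range of \<open>T (mat 1)\<close>. For the invertible \<open>A\<close> found below,
        \<open>T A *v v\<close> lies both in that range and on the line of \<open>z\<close>, so it
        is 0, contrary to the choice of \<open>v\<close>.\<close>
      then obtain v where v: "T (mat 1) *v v \<noteq> 0"
        by (metis matrix_eq matrix_vector_mult_0)
      obtain z where z: "z \<notin> range ((*v) (T (mat 1)))"
        using False matrix_right_invertible_surjective[of "T (mat 1)"] invertible_right_inverse by blast
      have "Vector_Spaces.linear matrix_scale (*s) (\<lambda>A. T A *v v)"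
        by (unfold_locales)
          (simp_all add: T.add T.scale matrix_vector_mult_add_rdistrib, simp add: matrix_scale_def matrix_vector_mult_def vec_eq_iff sum_distrib_left ac_simps)
      moreover have "z \<noteq> 0" using z by (metis matrix_vector_mult_0_right rangeI)
      ultimately obtain A c where A: "invertible A" "T A *v v = c *s z"
        using exists_invertible_mapped_into_line by blast
      obtain X Y where XY: "T A = T (mat 1) ** X" "T (mat 1) = Y ** T A" using HT[OF A(1)] by blast
      have "c = 0"
      proof (rule ccontr)
        assume "c \<noteq> 0"
        then have "z = T (mat 1) *v (inverse c *s (X *v v))"
          using A(2) by (simp add: XY(1) vec.scale flip: matrix_vector_mul_assoc)
        then show False using z by blast
      qed
      then have "T A *v v = 0" using A by simp
      then show False using v XY(2) by (metis matrix_vector_mul_assoc matrix_vector_mult_0_right)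
    qed
    then have "T A *v x = 0" if "invertible A" for A x
      using HT[OF that] by (metis matrix_vector_mul_assoc matrix_vector_mult_0)
    then show ?thesis by (simp add: matrix_eq)
  qed
qed

section \<open>Matrices of rank at most one\<close>

definition outer :: "'a::times^'m \<Rightarrow> 'a^'n \<Rightarrow> 'a^'n^'m"
  where "outer u v = (\<chi> i j. u $ i * v $ j)"

lemma outer_nth [simp]: "outer u v $ i $ j = u $ i * v $ j"
  by (simp add: outer_def)

lemma outer_add_right: "outer u (v + w) = outer u v + outer u w" for u :: "'a::semiring^'m"
  by (simp add: vec_eq_iff distrib_left)

lemma outer_add_left: "outer (u + v) w = outer u w + outer v w" for u :: "'a::semiring^'m"
  by (simp add: vec_eq_iff distrib_right)

lemma outer_scale_right: "outer u (c *s v) = matrix_scale c (outer u v)" for u :: "'a::comm_semiring^'m"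
  by (simp add: vec_eq_iff matrix_scale_def mult.left_commute)

lemma outer_scale_left: "outer (c *s u) v = outer u (c *s v)" for u :: "'a::comm_semiring^'m"
  by (simp add: vec_eq_iff mult.commute mult.left_commute)

lemma outer_zero [simp]: "outer u 0 = 0" "outer 0 v = 0" for u :: "'a::mult_zero^'m" and v :: "'a^'n"
  by (simp_all add: vec_eq_iff)

lemma outer_eq_0_iff: "outer u v = 0 \<longleftrightarrow> u = 0 \<or> v = 0" for u :: "'a::semiring_no_zero_divisors^'m"
  by (auto simp: vec_eq_iff)

lemma transpose_outer: "transpose (outer u v) = outer v u" for u :: "'a::comm_semiring^'m"
  by (simp add: vec_eq_iff transpose_def mult.commute)

lemma matrix_mult_outer: "A ** outer u v = outer (A *v u) v" for A :: "'a::comm_semiring_1^'n^'m"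
  by (simp add: vec_eq_iff matrix_matrix_mult_def matrix_vector_mult_def sum_distrib_right mult.assoc)

lemma outer_mult_matrix: "outer u v ** A = outer u (transpose A *v v)" for A :: "'a::comm_semiring_1^'n^'m"
  by (simp add: vec_eq_iff matrix_matrix_mult_def matrix_vector_mult_def transpose_def sum_distrib_left ac_simps)

lemma outer_mult_vector: "outer u v *v x = (\<Sum>i\<in>UNIV. v $ i * x $ i) *s u" for u :: "'a::comm_semiring_1^'m"
  by (simp add: vec_eq_iff matrix_vector_mult_def sum_distrib_left ac_simps)

lemma matrix_eq_sum_outer: "A = (\<Sum>i\<in>UNIV. outer (axis i 1) (row i A))" for A :: "'a::semiring_1^'n^'m"
  by (simp add: vec_eq_iff axis_def row_def if_distrib[of "\<lambda>z. z * _"] cong: if_cong)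

lemma matrix_vector_axis: "(A *v axis k 1) $ i = A $ i $ k" for A :: "'a::semiring_1^'n^'m"
  by (simp add: matrix_vector_mult_def axis_def if_distrib[of "\<lambda>z. _ * z"] cong: if_cong)

text \<open>Linear dependence as vanishing of all 2 x 2 minors: a symmetric form in which the zero
  vector is parallel to everything.\<close>

definition parallel :: "'a::times^'n \<Rightarrow> 'a^'n \<Rightarrow> bool"
  where "parallel u v \<longleftrightarrow> (\<forall>i j. u $ i * v $ j = u $ j * v $ i)"

lemma parallel_sym: "parallel u v \<Longrightarrow> parallel v u" for u :: "'a::ab_semigroup_mult^'n"
  unfolding parallel_def by (metis mult.commute)

lemma parallelE:
  fixes u v :: "'a::field^'n"
  assumes "parallel u v" "u \<noteq> 0"
  obtains c where "v = c *s u"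
proof -
  obtain k where k: "u $ k \<noteq> 0" using assms(2) by (auto simp: vec_eq_iff)
  have "v = (v $ k / u $ k) *s u"
    using assms(1) k by (simp add: vec_eq_iff parallel_def field_simps)
  then show ?thesis by (rule that)
qed

lemma parallel_scale: "parallel (c *s u) (d *s u)" for u :: "'a::comm_semiring_1^'n"
  by (simp add: parallel_def ac_simps)

text \<open>By Cauchy-Binet a 2 x 2 minor of the sum is the product of a minor of u, u' and a minor
  of v, v'. It vanishes because the sum is a single \<open>outer x y\<close>.\<close>

lemma outer_add_outer_rank_one:
  fixes u u' :: "'a::idom^'m" and v v' :: "'a^'n"
  assumes "outer u v + outer u' v' = outer x y"
  shows "parallel u u' \<or> parallel v v'"
proof (rule ccontr)
  assume "\<not> ?thesis"
  then obtain i k j l where ne: "u $ i * u' $ k - u $ k * u' $ i \<noteq> 0" "v $ j * v' $ l - v $ l * v' $ j \<noteq> 0"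
    unfolding parallel_def by auto
  have *: "u $ r * v $ s + u' $ r * v' $ s = x $ r * y $ s" for r s
    using arg_cong[OF assms, of "\<lambda>M. M $ r $ s"] by simp
  have "(u $ i * u' $ k - u $ k * u' $ i) * (v $ j * v' $ l - v $ l * v' $ j) =
    (u $ i * v $ j + u' $ i * v' $ j) * (u $ k * v $ l + u' $ k * v' $ l) -
    (u $ i * v $ l + u' $ i * v' $ l) * (u $ k * v $ j + u' $ k * v' $ j)"
    by algebra
  also have "\<dots> = 0" unfolding * by (simp add: algebra_simps)
  finally show False using ne by simp
qed

definition rank_le_1 :: "'a::times^'n^'m \<Rightarrow> bool"
  where "rank_le_1 A \<longleftrightarrow> (\<exists>u v. A = outer u v)"

text \<open>Any two values have parallel left or parallel right factors. If the left factors of two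
  nonzero values are not parallel, the right factor of these two is common to all values; otherwise
  all nonzero values share the left factor.\<close>

lemma rank_le_1_space:
  fixes G :: "'a::field^'k \<Rightarrow> 'a^'n^'m"
  assumes add: "\<And>x y. G (x + y) = G x + G y" and rank: "\<And>y. rank_le_1 (G y)"
  shows "(\<exists>u. \<forall>y. \<exists>v. G y = outer u v) \<or> (\<exists>v. \<forall>y. \<exists>u. G y = outer u v)"
proof -
  obtain f g where G: "\<And>y. G y = outer (f y) (g y)"
    using rank unfolding rank_le_1_def by metis
  have par: "parallel (f x) (f y) \<or> parallel (g x) (g y)" for x y
    using add[of x y] unfolding G by (metis outer_add_outer_rank_one)
  show ?thesis
  proof (cases "\<exists>y z. \<not> parallel (f y) (f z) \<and> G y \<noteq> 0 \<and> G z \<noteq> 0")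
    case True
    then obtain y z where yz: "\<not> parallel (f y) (f z)" "G y \<noteq> 0" "G z \<noteq> 0" by blast
    then have ne: "f y \<noteq> 0" "g y \<noteq> 0" "f z \<noteq> 0" "g z \<noteq> 0" by (auto simp: G)
    obtain c where c: "g z = c *s g y" using par yz(1) ne parallelE by metis
    have "\<exists>u. G w = outer u (g y)" for w
    proof (cases "parallel (g y) (g w)")
      case True
      then obtain d where "g w = d *s g y" using ne parallelE by metis
      then show ?thesis unfolding G by (metis outer_scale_left)
    next
      case False
      \<comment> \<open>With a right factor parallel to neither \<open>g y\<close> nor
        \<open>g z\<close>, the value at \<open>w\<close> has a left factor parallel to both
        \<open>f y\<close> and \<open>f z\<close>, which are not parallel to each other; so it is
        0.\<close>
      have "\<not> parallel (g z) (g w)"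
      proof
        assume "parallel (g z) (g w)"
        then obtain d where "g w = d *s g z" using ne parallelE by metis
        then show False using False c parallel_scale[of 1 "g y" "d * c"] by simp
      qed
      then have p: "parallel (f w) (f y)" "parallel (f w) (f z)"
        using par False parallel_sym by blast+
      have "f w = 0"
      proof (rule ccontr)
        assume "f w \<noteq> 0"
        then show False using p yz(1) parallelE parallel_scale by metis
      qed
      then show ?thesis unfolding G by (metis outer_zero(2))
    qed
    then show ?thesis by blast
  next
    case False
    show ?thesis
    proof (cases "\<exists>y. G y \<noteq> 0")
      case True
      then obtain y where y: "G y \<noteq> 0" by blast
      then have "f y \<noteq> 0" by (auto simp: G)
      have "\<exists>v. G w = outer (f y) v" for w
      proof (cases "G w = 0")
        case True
        then show ?thesis by (metis outer_zero(1))
      next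
        case F: False
        then have "parallel (f y) (f w)" using False y by blast
        then obtain d where "f w = d *s f y" using \<open>f y \<noteq> 0\<close> parallelE by metis
        then show ?thesis unfolding G by (metis outer_scale_left)
      qed
      then show ?thesis by blast
    next
      case False
      then show ?thesis by (metis outer_zero(1))
    qed
  qed
qed

section \<open>Injective linear maps that preserve rank at most one\<close>

text \<open>The basis vectors e_i force the off-diagonal entries to vanish, and the sums e_i + e_j
  force the diagonal entries to agree.\<close>

lemma scalar_if_all_eigenvectors:
  fixes N :: "'a::field^'n^'n"
  assumes "\<And>x. parallel x (N *v x)"
  shows "\<exists>c. \<forall>x. N *v x = c *s x"
proof -
  have off: "N $ j $ i = 0" if "i \<noteq> j" for i j
    using assms[of "axis i 1", unfolded parallel_def matrix_vector_axis, rule_format, of i j] that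
    by (simp add: axis_def)
  have diag: "N $ i $ i = N $ j $ j" for i j
  proof (cases "i = j")
    case False
    have "(N *v (axis i 1 + axis j 1)) $ k = N $ k $ i + N $ k $ j" for k
      by (simp add: matrix_vector_right_distrib matrix_vector_axis)
    then show ?thesis
      using assms[of "axis i 1 + axis j 1", unfolded parallel_def, rule_format, of i j] False off[of i j] off[of j i]
      by (simp add: axis_def)
  qed simp
  obtain k :: 'n where True by simp
  have "(N *v x) $ i = N $ k $ k * x $ i" for x i
  proof -
    have "(N *v x) $ i = (\<Sum>j\<in>UNIV. N $ i $ j * x $ j)" by (simp add: matrix_vector_mult_def)
    also have "\<dots> = (\<Sum>j\<in>UNIV. if j = i then N $ i $ i * x $ i else 0)"
      by (rule sum.cong) (auto simp: off)
    finally have "(N *v x) $ i = N $ i $ i * x $ i" by simp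
    then show ?thesis using diag[of i k] by simp
  qed
  then show ?thesis by (auto simp: vec_eq_iff)
qed

lemma invertible_surj:
  fixes M :: "'a::field^'n^'n"
  assumes "invertible M"
  obtains x where "M *v x = y"
proof -
  have "surj ((*v) M)"
    using assms matrix_right_invertible_surjective[of M] by (simp add: invertible_right_inverse)
  then obtain x where "y = M *v x" by (rule surjE)
  then show ?thesis using that by simp
qed

text \<open>The right factor is read off, linearly in \<open>y\<close>, from a row \<open>k\<close>
  with \<open>u $ k\<close> nonzero after division by that entry. Injectivity of \<open>T\<close>
  makes \<open>u\<close> nonzero and \<open>q\<close> invertible.\<close>

lemma row_type_obtains_matrix:
  fixes T :: "'a::field^'n^'n \<Rightarrow> 'a^'n^'n"
  assumes lin: "Vector_Spaces.linear matrix_scale matrix_scale T" and inj: "inj T"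
    and row: "\<And>y. \<exists>v. T (outer (axis i 1) y) = outer u v"
  obtains q where "u \<noteq> 0" "invertible q" "\<And>y. T (outer (axis i 1) y) = outer u (q *v y)"
proof -
  interpret T: Vector_Spaces.linear matrix_scale matrix_scale T by fact
  have ax: "axis i (1::'a) \<noteq> 0" by (simp add: axis_eq_0_iff)
  have T0: "T A = 0 \<longleftrightarrow> A = 0" for A
    using inj T.zero by (metis injD)
  have u0: "u \<noteq> 0"
    using row[of "axis i 1"] T0[of "outer (axis i 1) (axis i 1)"] ax by (auto simp: outer_eq_0_iff)
  then obtain k where k: "u $ k \<noteq> 0" by (auto simp: vec_eq_iff)
  define q where "q y = inverse (u $ k) *s row k (T (outer (axis i 1) y))" for y
  have "Vector_Spaces.linear (*s) (*s) q"
    by unfold_locales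
      (simp_all add: q_def outer_add_right outer_scale_right T.add T.scale row_def vec_eq_iff algebra_simps)
  note q = matrix_works[OF this]
  have T: "T (outer (axis i 1) y) = outer u (matrix q *v y)" for y
  proof -
    obtain v where v: "T (outer (axis i 1) y) = outer u v" using row by blast
    have "q y = v" unfolding q_def v using k by (simp add: vec_eq_iff row_def)
    then show ?thesis using v q by simp
  qed
  have "invertible (matrix q)"
    unfolding invertible_iff_ker
  proof (intro allI impI)
    fix y assume "matrix q *v y = 0"
    then have "T (outer (axis i 1) y) = 0" by (simp add: T)
    then show "y = 0" using T0 ax by (simp add: outer_eq_0_iff)
  qed
  then show ?thesis using that u0 T by blast
qed

text \<open>The left factors \<open>u i\<close> are pairwise non-parallel, so the images of (e_i +
  e_j) \<otimes> y have rank at most 1 only if \<open>q i *v y\<close> and \<open>q j *v y\<close>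
  are parallel for all \<open>y\<close>. Hence all \<open>q i\<close> are multiples of one matrix,
  and the multiples are absorbed into \<open>P\<close>.\<close>

lemma row_type_imp_equivalence:
  fixes T :: "'a::field^'n^'n \<Rightarrow> 'a^'n^'n"
  assumes lin: "Vector_Spaces.linear matrix_scale matrix_scale T" and inj: "inj T"
    and rank: "\<And>A. rank_le_1 A \<Longrightarrow> rank_le_1 (T A)"
    and rows: "\<And>i. \<exists>u. \<forall>y. \<exists>v. T (outer (axis i 1) y) = outer u v"
  shows "\<exists>P Q. \<forall>A. T A = P ** A ** Q"
proof -
  interpret T: Vector_Spaces.linear matrix_scale matrix_scale T by fact
  have "\<exists>u q. u \<noteq> 0 \<and> invertible q \<and> (\<forall>y. T (outer (axis i 1) y) = outer u (q *v y))" for i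
  proof -
    obtain u where "\<And>y. \<exists>v. T (outer (axis i 1) y) = outer u v" using rows by blast
    then show ?thesis by (rule row_type_obtains_matrix[OF lin inj]) blast
  qed
  then obtain u q where u0: "\<And>i. u i \<noteq> 0" and invq: "\<And>i. invertible (q i)"
    and q: "\<And>i y. T (outer (axis i 1) y) = outer (u i) (q i *v y)" by metis
  have npar: "\<not> parallel (u i) (u j)" if ij: "i \<noteq> j" for i j
  proof
    assume "parallel (u i) (u j)"
    then obtain c where c: "u j = c *s u i" using u0 parallelE by metis
    \<comment> \<open>Chosen so that a matrix living in row \<open>i\<close> and one living in row
      \<open>j\<close> have the same image; their entries at (j, i) are 0 and 1.\<close>
    obtain y where y: "q i *v y = c *s (q j *v axis i 1)" using invertible_surj[OF invq] by metis
    have "T (outer (axis i 1) y) = T (outer (axis j 1) (axis i 1))"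
      unfolding q y c by (simp add: outer_scale_left)
    then have "outer (axis i 1) y = outer (axis j 1) (axis i 1)" using inj by (simp add: inj_eq)
    then have "outer (axis i 1) y $ j $ i = outer (axis j 1) (axis i 1) $ j $ i" by simp
    then show False using ij by (simp add: axis_def)
  qed
  have par: "parallel (q i *v y) (q j *v y)" if "i \<noteq> j" for i j y
  proof -
    have "rank_le_1 (T (outer (axis i 1 + axis j 1) y))"
      by (rule rank) (auto simp: rank_le_1_def)
    then show ?thesis
      using npar[OF that] outer_add_outer_rank_one unfolding rank_le_1_def outer_add_left T.add q by metis
  qed
  obtain i0 :: 'n where True by simp
  have "\<exists>c. \<forall>y. q i *v y = c *s (q i0 *v y)" for i
  proof (cases "i = i0")
    case True
    then show ?thesis by (intro exI[of _ 1]) simp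
  next
    case False
    obtain R where R: "q i0 ** R = mat 1" "R ** q i0 = mat 1" using invq unfolding invertible_def by metis
    have "parallel x ((q i ** R) *v x)" for x
      using par[of i0 i "R *v x"] False R by (simp add: matrix_vector_mul_assoc)
    then obtain c where "\<And>x. (q i ** R) *v x = c *s x" using scalar_if_all_eigenvectors by blast
    then have "q i *v y = c *s (q i0 *v y)" for y
      using R by (metis matrix_mul_assoc matrix_mul_rid matrix_vector_mul_assoc)
    then show ?thesis by blast
  qed
  then obtain c where c: "\<And>i y. q i *v y = c i *s (q i0 *v y)" by metis
  define P where "P = (\<chi> r i. c i * u i $ r)"
  have "T A = P ** A ** transpose (q i0)" for A
  proof -
    have P: "P *v axis i 1 = c i *s u i" for i
      by (simp add: matrix_vector_axis P_def vec_eq_iff)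
    have "T A = (\<Sum>i\<in>UNIV. T (outer (axis i 1) (row i A)))"
      by (subst matrix_eq_sum_outer) (simp add: T.sum)
    also have "\<dots> = (\<Sum>i\<in>UNIV. P ** outer (axis i 1) (row i A) ** transpose (q i0))"
      unfolding matrix_mult_outer outer_mult_matrix P transpose_transpose outer_scale_left
      by (intro sum.cong refl) (simp only: q vec.scale flip: c)
    also have "\<dots> = P ** (\<Sum>i\<in>UNIV. outer (axis i 1) (row i A)) ** transpose (q i0)"
      using sum_comp_morphism[of "\<lambda>M. P ** M ** transpose (q i0)" "\<lambda>i. outer (axis i 1) (row i A)" UNIV]
      by (simp add: o_def matrix_add_ldistrib matrix_mult_add_right_distrib matrix_eq[of _ 0] flip: matrix_vector_mul_assoc)
    finally show ?thesis by (simp flip: matrix_eq_sum_outer)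
  qed
  then show ?thesis by blast
qed

section \<open>Linear preservers\<close>

text \<open>Flattening matrices to vectors indexed by pairs reduces the claim to injective
  endomorphisms of a coordinate space.\<close>

lemma inj_linear_imp_surj_matrix:
  fixes T :: "'a::field^'n^'m \<Rightarrow> 'a^'n^'m"
  assumes lin: "Vector_Spaces.linear matrix_scale matrix_scale T" and inj: "inj T"
  shows "surj T"
proof -
  interpret T: Vector_Spaces.linear matrix_scale matrix_scale T by fact
  define enc :: "'a^'n^'m \<Rightarrow> 'a^('m \<times> 'n)" where "enc A = (\<chi> p. A $ fst p $ snd p)" for A
  define dec :: "'a^('m \<times> 'n) \<Rightarrow> 'a^'n^'m" where "dec x = (\<chi> i j. x $ (i, j))" for x
  have ed: "enc (dec x) = x" and de: "dec (enc A) = A" for x A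
    by (simp_all add: enc_def dec_def vec_eq_iff)
  have "Vector_Spaces.linear (*s) (*s) (enc \<circ> T \<circ> dec)"
  proof unfold_locales
    show "(enc \<circ> T \<circ> dec) (x + y) = (enc \<circ> T \<circ> dec) x + (enc \<circ> T \<circ> dec) y" for x y
    proof -
      have "dec (x + y) = dec x + dec y" by (simp add: dec_def vec_eq_iff)
      then show ?thesis by (simp add: T.add) (simp add: enc_def vec_eq_iff)
    qed
    show "(enc \<circ> T \<circ> dec) (c *s x) = c *s (enc \<circ> T \<circ> dec) x" for c x
    proof -
      have "dec (c *s x) = matrix_scale c (dec x)" by (simp add: dec_def vec_eq_iff)
      then show ?thesis by (simp add: T.scale) (simp add: enc_def vec_eq_iff)
    qed
  qed
  moreover have "inj (enc \<circ> T \<circ> dec)"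
  proof (intro inj_compose inj)
    show "inj enc" "inj dec" using ed de by (auto intro: inj_on_inverseI)
  qed
  ultimately have "surj (enc \<circ> T \<circ> dec)" by (rule vec.linear_inj_imp_surj)
  show ?thesis
  proof (rule surjI)
    show "T (dec (inv (enc \<circ> T \<circ> dec) (enc A))) = A" for A
      using surj_f_inv_f[OF \<open>surj (enc \<circ> T \<circ> dec)\<close>, of "enc A"] de unfolding comp_def by metis
  qed
qed

section \<open>Rank at most one in terms of singular pencil members\<close>

text \<open>With A = u \<otimes> v, a kernel vector of X - rA is a multiple of X^-1 u. Applying the
  functional \<open>p\<close> of v and cancelling gives r * p(X^-1 u) = 1, which determines
  r.\<close>

lemma rank_le_1_pencil:
  fixes X A :: "'a::field^'n^'n"
  assumes "invertible X" "rank_le_1 A" "\<not> invertible (X - matrix_scale t A)" "\<not> invertible (X - matrix_scale s A)"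
  shows "t = s"
proof -
  obtain u v where A: "A = outer u v" using assms(2) unfolding rank_le_1_def by blast
  obtain X' where X': "X' ** X = mat 1" using assms(1) unfolding invertible_def by blast
  define p where "p x = (\<Sum>i\<in>UNIV. v $ i * x $ i)" for x
  have p: "p (c *s x) = c * p x" for c x
    by (simp add: p_def sum_distrib_left ac_simps)
  have "r * p (X' *v u) = 1" if sing: "\<not> invertible (X - matrix_scale r A)" for r
  proof -
    obtain x where x: "x \<noteq> 0" "(X - matrix_scale r A) *v x = 0"
      using sing unfolding invertible_iff_ker by blast
    then have "X *v x = (r * p x) *s u"
      by (simp add: matrix_vector_mult_diff_rdistrib matrix_scale_vector A outer_mult_vector p_def)
    then have eq: "x = (r * p x) *s (X' *v u)"
      using X' by (metis matrix_vector_mul_assoc matrix_vector_mul_lid vec.scale)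
    then have "p x \<noteq> 0" using x(1) by (metis mult_zero_right vec.scale_zero_left)
    moreover have "p x = r * p x * p (X' *v u)" using arg_cong[OF eq, of p] by (simp only: p)
    ultimately show ?thesis by simp
  qed
  then show ?thesis using assms(3,4) by (metis mult_cancel_right mult_zero_right zero_neq_one)
qed

lemma not_rank_le_1_pencil:
  fixes A :: "'a::field^'n^'n"
  assumes "\<not> rank_le_1 A" "c \<noteq> 0"
  obtains X where "invertible X" "\<not> invertible (X - matrix_scale 1 A)" "\<not> invertible (X - matrix_scale c A)"
proof -
  obtain C B :: "'a^'n^'n" and S where CB: "invertible C" "invertible B"
    and A: "A = C ** diag_matrix (indicator S) ** B"
    by (rule rank_normal_form[of A])
  have "S \<noteq> {}"
  proof
    assume "S = {}"
    then have "diag_matrix (indicator S) = outer 0 (0 :: 'a^'n)" by (simp add: vec_eq_iff diag_matrix_def)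
    then show False using assms(1) unfolding A rank_le_1_def by (metis matrix_mult_outer outer_mult_matrix)
  qed
  then obtain i where i: "i \<in> S" by blast
  have "S \<noteq> {i}"
  proof
    assume "S = {i}"
    then have "diag_matrix (indicator S) = outer (axis i 1) (axis i (1 :: 'a))"
      by (auto simp: vec_eq_iff diag_matrix_def axis_def)
    then show False using assms(1) unfolding A rank_le_1_def by (metis matrix_mult_outer outer_mult_matrix)
  qed
  then obtain j where j: "j \<in> S" "j \<noteq> i" using i by blast
  \<comment> \<open>Both \<open>i\<close> and \<open>j\<close> carry a 1 in the normal form of
    \<open>A\<close>, so subtracting \<open>A\<close> clears entry \<open>i\<close> of this diagonal
    and subtracting \<open>c\<close> times \<open>A\<close> clears entry \<open>j\<close>.\<close>
  define d where "d k = (if k = j then c else 1)" for k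
  define X where "X = C ** diag_matrix d ** B"
  have eq: "X - matrix_scale t A = C ** diag_matrix (\<lambda>k. d k - t * indicator S k) ** B" for t
  proof -
    have "C ** diag_matrix (\<lambda>k. d k - t * indicator S k) ** B + matrix_scale t A = X"
      unfolding A X_def equivalence_diag_pencil by simp
    then show ?thesis by (simp add: algebra_simps)
  qed
  have "invertible X"
    unfolding X_def using CB assms(2) by (simp add: invertible_diag_equiv d_def)
  moreover have "\<not> invertible (X - matrix_scale 1 A)"
    unfolding eq using CB i j by (auto simp: invertible_diag_equiv d_def intro!: exI[of _ i])
  moreover have "\<not> invertible (X - matrix_scale c A)"
    unfolding eq using CB i j by (auto simp: invertible_diag_equiv d_def intro!: exI[of _ j])
  ultimately show ?thesis by (rule that)
qed

text \<open>A root of X^n - X + 1, which takes the value 1 at both 0 and 1. For n = 1 the root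
  condition also holds in the field with two elements.\<close>

lemma exists_nontrivial_scalar:
  assumes root: "\<And>p :: 'a::field poly. degree p = n \<Longrightarrow> \<exists>x. poly p x = 0" and n: "n \<ge> 2"
  obtains c :: "'a::field" where "c \<noteq> 0" "c \<noteq> 1"
proof -
  have "degree (monom 1 n + [:1, -1:] :: 'a poly) = n"
    using n by (subst degree_add_eq_left) (auto simp: degree_monom_eq)
  then obtain c :: 'a where "poly (monom 1 n + [:1, -1:]) c = 0" using root by blast
  then have "c ^ n + (1 - c) = 0" by (simp add: poly_monom)
  then have "c \<noteq> 0" "c \<noteq> 1" using n by (auto simp: power_0_left)
  then show ?thesis by (rule that)
qed

lemma two_distinct_imp_card:
  fixes i j :: "'n::finite"
  assumes "i \<noteq> j"
  shows "CARD('n) \<ge> 2"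
  using card_mono[of "UNIV :: 'n set" "{i, j}"] assms by simp

lemma zero_on_invertible_imp_zero:
  fixes T :: "'a::field^'n^'n \<Rightarrow> 'a^'n^'n"
  assumes root: "\<And>p :: 'a poly. degree p = CARD('n) \<Longrightarrow> \<exists>x. poly p x = 0"
    and lin: "Vector_Spaces.linear matrix_scale matrix_scale T"
    and zero: "\<And>A. invertible A \<Longrightarrow> T A = 0"
  shows "T A = 0"
proof -
  interpret T: Vector_Spaces.linear matrix_scale matrix_scale T by fact
  obtain C B :: "'a^'n^'n" and S where CB: "invertible C" "invertible B"
    and A: "A = C ** diag_matrix (indicator S) ** B"
    by (rule rank_normal_form[of A])
  consider "S = UNIV" | "S = {}" | i j where "i \<in> S" "j \<notin> S" by blast
  then show ?thesis
  proof cases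
    case 1
    then show ?thesis unfolding A using CB by (intro zero) (simp add: invertible_diag_equiv)
  next
    case 2
    then have "diag_matrix (indicator S) = (0 :: 'a^'n^'n)" by (simp add: vec_eq_iff diag_matrix_def)
    then have "A = 0" by (simp add: A matrix_eq[of _ 0] flip: matrix_vector_mul_assoc)
    then show ?thesis by (simp add: T.zero)
  next
    case 3
    then have "CARD('n) \<ge> 2" using two_distinct_imp_card by metis
    from exists_nontrivial_scalar[OF root this] obtain c :: 'a where c: "c \<noteq> 0" "c \<noteq> 1" by metis
    \<comment> \<open>\<open>D\<close> and \<open>C ** B\<close> are both invertible and differ by
      the nonzero multiple \<open>c - 1\<close> of \<open>A\<close>.\<close>
    define D where "D = C ** diag_matrix (\<lambda>k. if k \<in> S then c else 1) ** B"
    have one: "diag_matrix (\<lambda>_. 1) = (mat 1 :: 'a^'n^'n)" by (simp add: diag_matrix_def mat_def)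
    have "C ** diag_matrix (\<lambda>_. 1) ** B + matrix_scale (c - 1) A = D"
      unfolding A D_def equivalence_diag_pencil by (rule arg_cong[of _ _ "\<lambda>d. C ** diag_matrix d ** B"]) auto
    then have "D = C ** B + matrix_scale (c - 1) A" by (simp add: one)
    moreover have "T D = 0"
      unfolding D_def using CB c by (intro zero) (auto simp: invertible_diag_equiv)
    moreover have "T (C ** B) = 0" using CB by (intro zero invertible_mult)
    ultimately have "matrix_scale (c - 1) (T A) = 0" by (simp add: T.add T.scale)
    then show ?thesis using c by (simp add: vec_eq_iff)
  qed
qed

lemma transpose_linear_inj:
  fixes T :: "'a::field^'n^'n \<Rightarrow> 'a^'n^'n"
  assumes lin: "Vector_Spaces.linear matrix_scale matrix_scale T" and inj: "inj T"
  shows "Vector_Spaces.linear matrix_scale matrix_scale (transpose \<circ> T)" "inj (transpose \<circ> T)"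
proof -
  interpret T: Vector_Spaces.linear matrix_scale matrix_scale T by fact
  have "transpose (M + N) = transpose M + transpose N"
    "transpose (matrix_scale c M) = matrix_scale c (transpose M)" for c and M N :: "'a^'n^'n"
    by (simp_all add: transpose_def vec_eq_iff)
  then show "Vector_Spaces.linear matrix_scale matrix_scale (transpose \<circ> T)"
    by unfold_locales (simp_all add: T.add T.scale)
  show "inj (transpose \<circ> T)"
    by (rule inj_compose[OF _ inj]) (rule inj_on_inverseI[of _ transpose], simp)
qed

text \<open>The images of rows i and j would both contain u \<otimes> v. By injectivity its preimage
  lives in two different rows, so it is 0, although \<open>v\<close> is nonzero.\<close>

lemma row_type_column_type_clash:
  fixes T :: "'a::field^'n^'n \<Rightarrow> 'a^'n^'n"
  assumes lin: "Vector_Spaces.linear matrix_scale matrix_scale T" and inj: "inj T" and ij: "i \<noteq> j"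
    and row: "\<And>y. \<exists>w. T (outer (axis i 1) y) = outer u w"
    and col: "\<And>y. \<exists>w. T (outer (axis j 1) y) = outer w v"
  shows False
proof -
  have col': "\<exists>w. (transpose \<circ> T) (outer (axis j 1) y) = outer v w" for y
    using col[of y] by (metis comp_apply transpose_outer)
  obtain q where q: "invertible q" "\<And>y. T (outer (axis i 1) y) = outer u (q *v y)"
    using row_type_obtains_matrix[OF lin inj row] by metis
  obtain r where v: "v \<noteq> 0" and r: "invertible r" "\<And>y. (transpose \<circ> T) (outer (axis j 1) y) = outer v (r *v y)"
    using row_type_obtains_matrix[OF transpose_linear_inj[OF lin inj] col'] by metis
  obtain x where x: "q *v x = v" using invertible_surj[OF q(1)] by metis
  obtain y where y: "r *v y = u" using invertible_surj[OF r(1)] by metis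
  have "T (outer (axis j 1) y) = outer u v"
    using r(2)[of y] y by (metis comp_apply transpose_outer transpose_transpose)
  then have "T (outer (axis i 1) x) = T (outer (axis j 1) y)" using q(2)[of x] x by simp
  then have "outer (axis i 1) x = outer (axis j 1) y" using inj by (simp add: inj_eq)
  then have "outer (axis i 1) x $ i = outer (axis j 1) y $ i" by simp
  then have "x = 0" using ij by (simp add: vec_eq_iff axis_def)
  then show False using x v by simp
qed

lemma invertible_preserver_form:
  fixes T :: "'a::field^'n^'n \<Rightarrow> 'a^'n^'n"
  assumes root: "\<And>p :: 'a poly. degree p = CARD('n) \<Longrightarrow> \<exists>x. poly p x = 0"
    and lin: "Vector_Spaces.linear matrix_scale matrix_scale T"
    and inv: "\<And>A. invertible A \<Longrightarrow> invertible (T A)"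
  shows "(\<exists>P Q. invertible P \<and> invertible Q \<and> (\<forall>A. T A = P ** A ** Q)) \<or>
    (\<exists>P Q. invertible P \<and> invertible Q \<and> (\<forall>A. T A = P ** transpose A ** Q))"
proof -
  interpret T: Vector_Spaces.linear matrix_scale matrix_scale T by fact
  have inv_iff: "invertible (T A) \<longleftrightarrow> invertible A" for A
  proof (rule iffI[OF _ inv], rule ccontr)
    assume TA: "invertible (T A)" and "\<not> invertible A"
    then obtain Y where "\<And>t. invertible (Y + matrix_scale t A)" using exists_invertible_pencil by blast
    then have "invertible (T Y + matrix_scale t (T A))" for t using inv by (metis T.add T.scale)
    then show False using exists_singular_in_pencil[OF root TA] by blast
  qed
  have T0: "A = 0" if "T A = 0" for A
  proof (rule ccontr)
    assume "A \<noteq> 0"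
    obtain C B :: "'a^'n^'n" and S where CB: "invertible C" "invertible B"
      and A: "A = C ** diag_matrix (indicator S) ** B"
      by (rule rank_normal_form[of A])
    have "S \<noteq> {}"
    proof
      assume "S = {}"
      then have "diag_matrix (indicator S) = (0 :: 'a^'n^'n)" by (simp add: vec_eq_iff diag_matrix_def)
      then show False using \<open>A \<noteq> 0\<close> by (simp add: A matrix_eq[of _ 0] flip: matrix_vector_mul_assoc)
    qed
    \<comment> \<open>\<open>X\<close> is minus \<open>C ** B\<close>, so adding \<open>A\<close>
      produces a zero diagonal entry at every index of \<open>S\<close> while \<open>T\<close>
      cannot tell \<open>X + A\<close> from \<open>X\<close>.\<close>
    define X where "X = C ** diag_matrix (\<lambda>_. -1) ** B"
    have "X + matrix_scale 1 A = C ** diag_matrix (\<lambda>k. -1 + 1 * indicator S k) ** B"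
      unfolding X_def A equivalence_diag_pencil ..
    moreover have "matrix_scale 1 A = A" by (simp add: vec_eq_iff)
    ultimately have "X + A = C ** diag_matrix (\<lambda>k. -1 + indicator S k) ** B" by simp
    then have "\<not> invertible (X + A)"
      using CB \<open>S \<noteq> {}\<close> by (auto simp: invertible_diag_equiv) (metis indicator_simps(1))
    moreover have "invertible X" unfolding X_def using CB by (simp add: invertible_diag_equiv)
    moreover have "T (X + A) = T X" using that by (simp add: T.add)
    ultimately show False using inv_iff by metis
  qed
  have inj: "inj T"
  proof (rule injI)
    fix A B assume "T A = T B"
    then have "T (A - B) = 0" by (simp add: T.diff)
    then have "A - B = 0" by (rule T0)
    then show "A = B" by simp
  qed
  have rank: "rank_le_1 (T A)" if "rank_le_1 A" for A
  proof (rule ccontr)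
    assume no: "\<not> rank_le_1 (T A)"
    \<comment> \<open>For n = 1 every matrix has rank at most 1; for larger n a scalar
      \<open>c\<close> other than 0 and 1 is available, giving two distinct parameters for the
      pencil test.\<close>
    have "CARD('n) \<ge> 2"
    proof (rule ccontr)
      assume "\<not> ?thesis"
      then have "i = j" for i j :: 'n using two_distinct_imp_card by metis
      then have "T A = outer (\<chi> i. T A $ i $ i) (\<chi> i. 1)" by (simp add: vec_eq_iff) metis
      then show False using no unfolding rank_le_1_def by blast
    qed
    from exists_nontrivial_scalar[OF root this] obtain c :: 'a where c: "c \<noteq> 0" "c \<noteq> 1" by metis
    obtain X where X: "invertible X" "\<not> invertible (X - matrix_scale 1 (T A))" "\<not> invertible (X - matrix_scale c (T A))"
      using not_rank_le_1_pencil[OF no c(1)] by blast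
    \<comment> \<open>Surjectivity pulls the pencil of \<open>T A\<close> back to one of
      \<open>A\<close> that is singular at 1 and at \<open>c\<close>.\<close>
    obtain Y where Y: "X = T Y" using inj_linear_imp_surj_matrix[OF lin inj] by (metis surjD)
    have "\<not> invertible (Y - matrix_scale 1 A)" "\<not> invertible (Y - matrix_scale c A)" "invertible Y"
      using X unfolding Y by (metis inv_iff T.diff T.scale)+
    then show False using rank_le_1_pencil[OF _ that] c(2) by metis
  qed
  have space: "(\<exists>u. \<forall>y. \<exists>v. T (outer (axis i 1) y) = outer u v) \<or> (\<exists>v. \<forall>y. \<exists>u. T (outer (axis i 1) y) = outer u v)" for i
  proof (rule rank_le_1_space)
    show "rank_le_1 (T (outer (axis i 1) y))" for y by (rule rank) (auto simp: rank_le_1_def)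
  qed (simp add: outer_add_right T.add)
  \<comment> \<open>If the alternatives were mixed, some index would be of row type and a different
    one of column type.\<close>
  have dich: "(\<forall>i. \<exists>u. \<forall>y. \<exists>v. T (outer (axis i 1) y) = outer u v) \<or> (\<forall>i. \<exists>v. \<forall>y. \<exists>u. T (outer (axis i 1) y) = outer u v)"
    using space row_type_column_type_clash[OF lin inj] by metis
  have invPQ: "invertible P \<and> invertible Q" if "\<forall>A. T A = P ** A ** Q" for P Q
  proof -
    have "invertible (P ** Q)" using that inv[of "mat 1"] by (simp add: invertible_det_nz)
    then show ?thesis by (simp add: invertible_det_nz det_mul)
  qed
  have invPQ': "invertible P \<and> invertible Q" if "\<forall>A. T A = P ** transpose A ** Q" for P Q
  proof -
    have "invertible (P ** Q)" using that inv[of "mat 1"] by (simp add: invertible_det_nz)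
    then show ?thesis by (simp add: invertible_det_nz det_mul)
  qed
  from dich show ?thesis
  proof
    assume "\<forall>i. \<exists>u. \<forall>y. \<exists>v. T (outer (axis i 1) y) = outer u v"
    then show ?thesis using row_type_imp_equivalence[OF lin inj rank] invPQ by metis
  next
    assume cols: "\<forall>i. \<exists>v. \<forall>y. \<exists>u. T (outer (axis i 1) y) = outer u v"
    \<comment> \<open>Transposing the values turns column type into row type.\<close>
    have "\<exists>P Q. \<forall>A. (transpose \<circ> T) A = P ** A ** Q"
    proof (rule row_type_imp_equivalence[OF transpose_linear_inj[OF lin inj]])
      show "rank_le_1 ((transpose \<circ> T) A)" if "rank_le_1 A" for A
        using rank[OF that] unfolding rank_le_1_def by (metis comp_apply transpose_outer)
      show "\<exists>u. \<forall>y. \<exists>v. (transpose \<circ> T) (outer (axis i 1) y) = outer u v" for i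
        using cols by (metis comp_apply transpose_outer)
    qed
    then obtain P Q where "\<And>A. transpose (T A) = P ** A ** Q" by (auto simp: o_def)
    then have "\<forall>A. T A = transpose Q ** transpose A ** transpose P"
      by (metis matrix_mul_assoc matrix_transpose_mul transpose_transpose)
    then show ?thesis using invPQ' by blast
  qed
qed

section \<open>Green's relation H under equivalence and transposition\<close>

text \<open>A left multiplier X becomes P X P^-1 and a right multiplier becomes Q^-1 X Q.\<close>

lemma green_H_equivalence:
  fixes A B P Q :: "'a::field^'n^'n"
  assumes P: "invertible P" and Q: "invertible Q" and H: "green_H A B"
  shows "green_H (P ** A ** Q) (P ** B ** Q)"
proof -
  obtain P' Q' where PQ: "P' ** P = mat 1" "Q ** Q' = mat 1" using P Q unfolding invertible_def by blast
  have L: "\<exists>Z. P ** A ** Q = Z ** (P ** B ** Q)" if "A = X ** B" for A B X :: "'a^'n^'n"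
  proof
    have "P ** X ** P' ** (P ** B ** Q) = P ** X ** (P' ** P) ** B ** Q" by (simp only: matrix_mul_assoc)
    then show "P ** A ** Q = (P ** X ** P') ** (P ** B ** Q)" using PQ that by (simp add: matrix_mul_assoc)
  qed
  have R: "\<exists>Z. P ** A ** Q = (P ** B ** Q) ** Z" if "A = B ** X" for A B X :: "'a^'n^'n"
  proof
    have "(P ** B ** Q) ** (Q' ** X ** Q) = P ** B ** (Q ** Q') ** X ** Q" by (simp only: matrix_mul_assoc)
    then show "P ** A ** Q = (P ** B ** Q) ** (Q' ** X ** Q)" using PQ that by (simp add: matrix_mul_assoc)
  qed
  obtain X Y Z W where XY: "A = X ** B" "B = Y ** A" and ZW: "A = B ** Z" "B = A ** W"
    using H unfolding green_H_def green_L_def green_R_def by blast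
  show ?thesis
    unfolding green_H_def green_L_def green_R_def
    using L[OF XY(1)] L[OF XY(2)] R[OF ZW(1)] R[OF ZW(2)] by blast
qed

text \<open>Transposition reverses products and so exchanges the relations L and R, whose
  conjunction is H.\<close>

lemma green_H_transpose:
  fixes A B :: "'a::comm_semiring_1^'n^'n"
  assumes "green_H A B"
  shows "green_H (transpose A) (transpose B)"
proof -
  obtain X Y Z W where "A = X ** B" "B = Y ** A" "A = B ** Z" "B = A ** W"
    using assms unfolding green_H_def green_L_def green_R_def by blast
  then have "transpose A = transpose B ** transpose X" "transpose B = transpose A ** transpose Y"
    "transpose A = transpose Z ** transpose B" "transpose B = transpose W ** transpose A"
    by (metis matrix_transpose_mul)+
  then show ?thesis unfolding green_H_def green_L_def green_R_def by blast
qed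

theorem corollary4p5:
  fixes T :: "'a::field^'n^'n \<Rightarrow> 'a^'n^'n"
  assumes root: "\<And>p :: 'a poly. degree p = CARD('n) \<Longrightarrow> \<exists>x. poly p x = 0"
    and lin: "Vector_Spaces.linear matrix_scale matrix_scale T"
  shows "preserves_H T \<longleftrightarrow>
    (T = (\<lambda>A. 0)) \<or>
    (\<exists>P Q. invertible P \<and> invertible Q \<and> (\<forall>A. T A = P ** A ** Q)) \<or>
    (\<exists>P Q. invertible P \<and> invertible Q \<and> (\<forall>A. T A = P ** transpose A ** Q))"
    (is "_ \<longleftrightarrow> ?zero \<or> ?form")
proof
  assume "preserves_H T"
  from preserves_H_linear_cases[OF lin this] show "?zero \<or> ?form"
  proof
    assume zero: "\<forall>A. invertible A \<longrightarrow> T A = 0"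
    have "T A = 0" for A
      by (rule zero_on_invertible_imp_zero[OF root lin]) (use zero in blast)+
    then show ?thesis by blast
  next
    assume inv: "\<forall>A. invertible A \<longrightarrow> invertible (T A)"
    have ?form by (rule invertible_preserver_form[OF root lin]) (use inv in blast)+
    then show ?thesis by blast
  qed
next
  assume form: "?zero \<or> ?form"
  show "preserves_H T"
    unfolding preserves_H_def
  proof (intro allI impI)
    fix A B :: "'a^'n^'n"
    assume H: "green_H A B"
    have refl: "green_H C C" for C :: "'a^'n^'n"
      unfolding green_H_def green_L_def green_R_def by (metis matrix_mul_lid matrix_mul_rid)
    from form consider "T = (\<lambda>A. 0)"
      | P Q where "invertible P" "invertible Q" "\<And>A. T A = P ** A ** Q"
      | P Q where "invertible P" "invertible Q" "\<And>A. T A = P ** transpose A ** Q"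
      by blast
    then show "green_H (T A) (T B)"
    proof cases
      case 1
      then show ?thesis by (simp add: refl)
    next
      case 2
      then show ?thesis using green_H_equivalence[OF _ _ H] by simp
    next
      case 3
      then show ?thesis using green_H_equivalence[OF _ _ green_H_transpose[OF H]] by simp
    qed
  qed
qed

end
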